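(* Let $P_d\in\mathbb{Z}$ with $P_d>1$, let $\chi_0\ge 0$, and let $g_0:\mathbb{Z}\to\mathbb{R}$ satisfy: $g_0(t)=0$ for $t<0$, $g_0(0)>0$, $\sum_{t}|g_0(t)|<\infty$, the support of $g_0$ is $\{0,1,2,\dots\}$, $g_0$ is strictly monotonically decreasing on its support, and $g_0$ is convex on its support, i.e. $g_0(t+1)-g_0(t)\ge g_0(t)-g_0(t-1)$ for all $t\ge 1$. Consider the system $$u(t)=-\mathcal{C}_{g_0}(\mathrm{rel}_{\chi_0}(u))(t-P_d),\qquad t\in\mathbb{Z}.\qquad(\ast)$$ Let $u$ be any self-oscillation of $(\ast)$ of period $P\ge P_d$ (i.e. $u$ is $P$-periodic, satisfies $(\ast)$, and $S_c^-(\Delta_c u^P)\ge 2$) such that $S_c^-(\Delta_c u^P)=2$ and $S_c^+(\mathrm{rel}_{\chi_0}(u^P))=2$. Then $$2P_d\le P\le 4P_d+2.$$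
   Context: Convolution operator: $\mathcal{C}_{g_0}(x)(t)=\sum_{\tau\in\mathbb{Z}}g_0(t-\tau)x(\tau)$ for bounded $x:\mathbb{Z}\to\mathbb{R}$. Support: $\mathrm{supp}(g_0)=\{i\in\mathbb{Z}: g_0(i)\neq 0\}$. Truncation: for a $P$-periodic sequence $x$, $x^P=[x(0),\dots,x(P-1)]^\top\in\mathbb{R}^P$. Relay with dead zone: for $\chi_0\ge 0$ and $x\in\mathbb{R}$, $\mathrm{rel}_{\chi_0}(x)=1$ if $x>\chi_0$, $-1$ if $x<-\chi_0$, and $0$ otherwise; applied entrywise to vectors and sequences. Cyclic forward difference: for $v\in\mathbb{R}^n$, $\Delta_c v=[v_2-v_1,\,v_3-v_2,\dots,v_n-v_{n-1},\,v_1-v_n]^\top$. Variation: for $v\neq 0$, $S^-(v)$ is the number of sign changes between consecutive entries of the vector obtained from $v$ by deleting all zeros; $S^-(0)=-1$. Cyclic variation: $S_c^-(v)=\max_{1\le i\le n}S^-([v_i,\dots,v_n,v_1,\dots,v_i])$. $S_c^+(v)$ is the maximum of $S_c^-(\bar v)$ over all $\bar v\in\mathbb{R}^n$ obtained from $v$ by replacing its zero entries by arbitrary real numbers. *)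

theory Defs
  imports "HOL-Analysis.Infinite_Sum"
begin

definition conv_op :: "(int \<Rightarrow> real) \<Rightarrow> (int \<Rightarrow> real) \<Rightarrow> int \<Rightarrow> real" where
  "conv_op g x t = (\<Sum>\<^sub>\<infinity>\<tau>\<in>UNIV. g (t - \<tau>) * x \<tau>)"

definition supp :: "(int \<Rightarrow> real) \<Rightarrow> int set" where
  "supp g = {i. g i \<noteq> 0}"

text \<open>Vectors in \<open>\<real>\<^sup>n\<close> are lists of length \<open>n\<close>, since the dimension of a truncation is
  the period, a variable of the statements about it.\<close>

definition truncation :: "int \<Rightarrow> (int \<Rightarrow> real) \<Rightarrow> real list" where
  "truncation P x = map x [0..P - 1]"

definition rel :: "real \<Rightarrow> real \<Rightarrow> real" where
  "rel \<chi> x = (if x > \<chi> then 1 else if x < - \<chi> then - 1 else 0)"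

definition cyc_diff :: "real list \<Rightarrow> real list" where
  "cyc_diff v = map (\<lambda>i. v ! (Suc i mod length v) - v ! i) [0..<length v]"

definition variation :: "real list \<Rightarrow> int" where
  "variation v =
     (if \<forall>x\<in>set v. x = 0 then - 1
      else let w = filter (\<lambda>x. x \<noteq> 0) v
           in int (card {i. Suc i < length w \<and> w ! i * w ! Suc i < 0}))"

text \<open>Indices start at 0: \<open>drop i v @ take (Suc i) v\<close> is the rotation of \<open>v\<close> starting at
  entry \<open>i\<close>, with that entry repeated at the end.\<close>

definition cyc_variation :: "real list \<Rightarrow> int" where
  "cyc_variation v = Max ((\<lambda>i. variation (drop i v @ take (Suc i) v)) ` {..<length v})"

text \<open>The set below is infinite in its index \<open>w\<close>, but its values lie between \<open>- 1\<close> and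
  \<open>length v\<close>, so for nonempty \<open>v\<close> the maximum is attained.\<close>

definition cyc_variation_plus :: "real list \<Rightarrow> int" where
  "cyc_variation_plus v =
     Max {cyc_variation w | w. length w = length v \<and> (\<forall>i<length v. v ! i \<noteq> 0 \<longrightarrow> w ! i = v ! i)}"

definition periodic :: "int \<Rightarrow> (int \<Rightarrow> real) \<Rightarrow> bool" where
  "periodic P x \<longleftrightarrow> P > 0 \<and> (\<forall>t. x (t + P) = x t)"

definition relay_system :: "(int \<Rightarrow> real) \<Rightarrow> real \<Rightarrow> int \<Rightarrow> (int \<Rightarrow> real) \<Rightarrow> bool" where
  "relay_system g \<chi> Pd u \<longleftrightarrow> (\<forall>t. u t = - conv_op g (\<lambda>\<tau>. rel \<chi> (u \<tau>)) (t - Pd))"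

definition self_oscillation ::
    "(int \<Rightarrow> real) \<Rightarrow> real \<Rightarrow> int \<Rightarrow> int \<Rightarrow> (int \<Rightarrow> real) \<Rightarrow> bool" where
  "self_oscillation g \<chi> Pd P u \<longleftrightarrow>
     periodic P u \<and> relay_system g \<chi> Pd u \<and> cyc_variation (cyc_diff (truncation P u)) \<ge> 2"

end

theory Submission
  imports Defs
begin

text \<open>
  Write \<open>s t = rel \<chi>0 (u t)\<close> and \<open>y t = (\<Sum>k. g0 k * s (t - k))\<close>, so that
  \<open>u t = - y (t - Pd)\<close>.

  \<^bold>\<open>Shape of \<open>s\<close>.\<close> The condition \<open>S\<^sub>c\<^sup>+ = 2\<close> forbids four cyclically ordered times at which
  \<open>s\<close> is \<open>\<ge> 0\<close>, \<open>\<le> 0\<close>, \<open>\<ge> 0\<close>, \<open>\<le> 0\<close>, because zeros may be replaced by either sign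
  (\<open>no_weak_alternation\<close>). As \<open>s\<close> takes both signs, one period of it is a block of \<open>a\<close> ones,
  \<open>z\<close> zeros, a block of \<open>b\<close> minus ones and \<open>z'\<close> zeros, with \<open>z, z' \<le> 1\<close>
  (\<open>two_block_word_exists\<close>).

  \<^bold>\<open>Lower bound.\<close> Since \<open>g0\<close> decreases to 0,
  \<open>y t - y (t - 1) = (\<Sum>k\<ge>1. (g0 (k - 1) - g0 k) * (s t - s (t - k)))\<close>, so \<open>y\<close> does not fall on
  steps into a time with \<open>s t = 1\<close>. Hence \<open>u\<close> peaks when the block of minus ones ends, shifted by
  \<open>Pd\<close> (or one step later, if a zero follows that block). The peak must lie in the block of ones,
  which gives \<open>Pd \<le> a + z'\<close> (\<open>delay_le_block\<close>). By the symmetry \<open>u \<mapsto> - u\<close> also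
  \<open>Pd \<le> b + z\<close>, and the sum of the two is \<open>2 * Pd \<le> P\<close>.

  \<^bold>\<open>Upper bound.\<close> By the same symmetry let \<open>b \<le> a\<close>. At the last time of the block of ones \<open>u\<close>
  exceeds \<open>\<chi>0 \<ge> 0\<close>, so \<open>y\<close> is negative \<open>Pd\<close> steps earlier. Looking back from there, each period
  of \<open>s\<close> shows \<open>a - Pd\<close> ones, then \<open>b\<close> minus ones, then \<open>Pd\<close> ones, apart from the isolated zeros.
  If \<open>P > 4 * Pd + 2\<close>, the recent ones are so many that, for a decreasing convex kernel, the two
  outer blocks outweigh the inner one (\<open>convex_block_inequality\<close>). Then every period contributes a
  nonnegative amount to \<open>y\<close>, a contradiction (\<open>period_le_of_longer_block\<close>).
\<close>

section \<open>Periodic functions on the integers\<close>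

lemma first_exit:
  fixes x y :: int
  assumes "x \<le> y" "Q x" "\<not> Q y"
  obtains c where "x < c" "c \<le> y" "\<not> Q c" "\<And>t. x \<le> t \<Longrightarrow> t < c \<Longrightarrow> Q t"
proof -
  define n where "n = (LEAST n. \<not> Q (x + int n))"
  have ex: "\<not> Q (x + int (nat (y - x)))" using assms by simp
  have n: "\<not> Q (x + int n)" unfolding n_def by (rule LeastI) (rule ex)
  have le: "n \<le> nat (y - x)" unfolding n_def by (rule Least_le) (rule ex)
  have before: "Q t" if "x \<le> t" "t < x + int n" for t
    using not_less_Least[of "nat (t - x)" "\<lambda>n. \<not> Q (x + int n)"] that
    by (auto simp: n_def[symmetric])
  have "n \<noteq> 0" using n assms by (intro notI) auto
  show ?thesis
    by (rule that[of "x + int n"]) (use n le before \<open>n \<noteq> 0\<close> assms in auto)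
qed

lemma int_step_mono:
  fixes f :: "int \<Rightarrow> real"
  assumes "x \<le> y" "\<And>t. x \<le> t \<Longrightarrow> t < y \<Longrightarrow> f t \<le> f (t + 1)"
  shows "f x \<le> f y"
  using assms
proof (induction y rule: int_ge_induct)
  case (step i)
  have "f x \<le> f i" using step by simp
  also have "\<dots> \<le> f (i + 1)" using step by simp
  finally show ?case .
qed simp

lemma periodic_mult:
  assumes "periodic P f"
  shows "f (t + k * P) = f t"
proof -
  have nat: "f (t + int n * P) = f t" for n t
  proof (induction n)
    case (Suc n)
    have "f (t + int (Suc n) * P) = f ((t + int n * P) + P)" by (simp add: algebra_simps)
    then show ?case using assms Suc by (simp add: periodic_def)
  qed simp
  show ?thesis
  proof (cases "k \<ge> 0")
    case True then show ?thesis using nat[of t "nat k"] by simp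
  next
    case False then show ?thesis using nat[of "t + k * P" "nat (- k)"] by (simp add: algebra_simps)
  qed
qed

lemma periodic_mod:
  assumes "periodic P f"
  shows "f (t mod P) = f t"
  using periodic_mult[OF assms, of "t mod P" "t div P"] by (simp add: mod_mult_div_eq)

lemma periodic_representative:
  assumes "periodic P f"
  obtains t' where "x \<le> t'" "t' < x + P" "f t' = f t"
proof -
  have P: "P > 0" using assms by (simp add: periodic_def)
  have "x + (t - x) mod P = t + (- ((t - x) div P)) * P"
    using mod_div_mult_eq[of "t - x" P] by (simp add: algebra_simps)
  then have "f (x + (t - x) mod P) = f t" using periodic_mult[OF assms] by metis
  then show ?thesis using that[of "x + (t - x) mod P"] P by simp
qed

section \<open>Cyclic variation\<close>

lemma variation_bounds: "- 1 \<le> variation v" "variation v \<le> int (length v)"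
proof -
  have "card {i. Suc i < length w \<and> w ! i * w ! Suc i < 0} \<le> length v"
    if "w = filter (\<lambda>x. x \<noteq> 0) v" for w
  proof -
    have "card {i. Suc i < length w \<and> w ! i * w ! Suc i < 0} \<le> card {..<length w}"
      by (rule card_mono) auto
    then show ?thesis using that le_trans[OF _ length_filter_le] by simp
  qed
  then show "- 1 \<le> variation v" "variation v \<le> int (length v)"
    by (auto simp: variation_def Let_def)
qed

lemma cyc_variation_attained:
  assumes "v \<noteq> []"
  obtains i where "i < length v" "cyc_variation v = variation (drop i v @ take (Suc i) v)"
proof -
  have "cyc_variation v \<in> (\<lambda>i. variation (drop i v @ take (Suc i) v)) ` {..<length v}"
    unfolding cyc_variation_def using assms by (intro Max_in) auto
  then show ?thesis using that by auto
qed

lemma cyc_variation_zero: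
  assumes "v \<noteq> []" "\<forall>x\<in>set v. x = 0"
  shows "cyc_variation v = - 1"
proof -
  obtain i where i: "cyc_variation v = variation (drop i v @ take (Suc i) v)"
    using cyc_variation_attained[OF assms(1)] by blast
  have "\<forall>x\<in>set (drop i v @ take (Suc i) v). x = 0"
    using assms(2) set_drop_subset[of i v] set_take_subset[of "Suc i" v] by auto
  then show ?thesis by (simp add: i variation_def)
qed

text \<open>The maximum over all replacements of zeros runs over infinitely many lists, so an upper bound
  by it needs the finiteness of its set of values.\<close>

lemma cyc_variation_le_plus:
  assumes "v \<noteq> []" "length w = length v" "\<And>i. i < length v \<Longrightarrow> v ! i \<noteq> 0 \<Longrightarrow> w ! i = v ! i"
  shows "cyc_variation w \<le> cyc_variation_plus v"
proof -
  let ?S = "{cyc_variation w | w. length w = length v \<and> (\<forall>i<length v. v ! i \<noteq> 0 \<longrightarrow> w ! i = v ! i)}"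
  have "?S \<subseteq> {- 1..int (length v) + 1}"
  proof
    fix x assume "x \<in> ?S"
    then obtain w where w: "x = cyc_variation w" "length w = length v" by auto
    then obtain i where i: "i < length w" "x = variation (drop i w @ take (Suc i) w)"
      using cyc_variation_attained[of w] assms(1) by (metis length_0_conv)
    then have "length (drop i w @ take (Suc i) w) = length v + 1" using w by auto
    then show "x \<in> {- 1..int (length v) + 1}"
      using variation_bounds[of "drop i w @ take (Suc i) w"] i by simp
  qed
  then have "finite ?S" by (rule finite_subset) simp
  then show ?thesis unfolding cyc_variation_plus_def using assms by (intro Max_ge) auto
qed

text \<open>The rotation starting at entry 0 repeats that entry at the end, so it already sees the sign
  change across the seam, and without zeros no entry is deleted.\<close>

lemma cyc_variation_ge_sign_changes:
  assumes per: "periodic P w" and nz: "\<And>t. w t \<noteq> 0"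
  shows "int (card {t \<in> {0..<P}. w t * w (t + 1) < 0}) \<le> cyc_variation (truncation P w)"
proof -
  define L where "L = truncation P w"
  define n where "n = nat P"
  have P: "P > 0" "int n = P" using per by (auto simp: periodic_def n_def)
  have len: "length L = n" by (simp add: L_def truncation_def n_def)
  have nth: "(drop 0 L @ take (Suc 0) L) ! i = w (int i)" if "i \<le> n" for i
  proof (cases "i < n")
    case True then show ?thesis using len P by (simp add: nth_append L_def truncation_def)
  next
    case False
    have w: "w (int i) = w 0"
      using False that P periodic_mult[OF per, of 0 1] by (simp add: order_antisym)
    have "(drop 0 L @ take (Suc 0) L) ! i = L ! 0"
      using False that len P by (simp add: nth_append)
    also have "\<dots> = w 0" using P by (simp add: L_def truncation_def)
    finally show ?thesis using w by simp
  qed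
  have ln: "length (drop 0 L @ take (Suc 0) L) = Suc n" using len P by simp
  have nonz: "\<forall>x\<in>set (drop 0 L @ take (Suc 0) L). x \<noteq> 0"
    using nth nz ln by (auto simp only: in_set_conv_nth less_Suc_eq_le)
  then have fil: "filter (\<lambda>x. x \<noteq> 0) (drop 0 L @ take (Suc 0) L) = drop 0 L @ take (Suc 0) L"
    by (intro filter_True)
  have "L \<noteq> []" using len P by auto
  then have nall: "\<not> (\<forall>x\<in>set (drop 0 L @ take (Suc 0) L). x = 0)"
    using nonz by (cases L) auto
  have "variation (drop 0 L @ take (Suc 0) L)
      = int (card {i. Suc i < Suc n \<and> w (int i) * w (int (Suc i)) < 0})"
    unfolding variation_def Let_def fil ln using nall
    by (simp only: if_False) (intro arg_cong[of _ _ "\<lambda>S. int (card S)"] Collect_cong conj_cong refl, simp only: nth)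
  also have "card {i. Suc i < Suc n \<and> w (int i) * w (int (Suc i)) < 0}
      = card {t \<in> {0..<P}. w t * w (t + 1) < 0}"
    by (rule bij_betw_same_card[of int], rule bij_betwI[where g = nat])
       (use P in \<open>auto simp: add.commute\<close>)
  finally have "int (card {t \<in> {0..<P}. w t * w (t + 1) < 0}) = variation (drop 0 L @ take (Suc 0) L)"
    by simp
  also have "\<dots> \<le> cyc_variation L"
    unfolding cyc_variation_def using len P by (intro Max_ge imageI) auto
  finally show ?thesis by (simp add: L_def)
qed

text \<open>Each of the four arcs between consecutive times, the last one wrapping around, contains a sign
  change. The four changes lie within one period, hence stay distinct modulo \<open>P\<close>.\<close>

lemma four_alternations:
  fixes w :: "int \<Rightarrow> real"
  assumes per: "periodic P w" and nz: "\<And>t. w t \<noteq> 0"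
    and ord: "t1 < t2" "t2 < t3" "t3 < t4" "t4 < t1 + P"
    and sgn: "w t1 > 0" "w t2 < 0" "w t3 > 0" "w t4 < 0"
  shows "card {t \<in> {0..<P}. w t * w (t + 1) < 0} \<ge> 4"
proof -
  have down: "\<exists>c. x \<le> c \<and> c < y \<and> w c * w (c + 1) < 0" if "x < y" "w x > 0" "w y < 0" for x y
  proof -
    obtain c where c: "x < c" "c \<le> y" "\<not> w c > 0" "\<And>t. x \<le> t \<Longrightarrow> t < c \<Longrightarrow> w t > 0"
      using first_exit[of x y "\<lambda>t. w t > 0"] \<open>x < y\<close> \<open>w x > 0\<close> \<open>w y < 0\<close> by auto
    then show ?thesis using nz[of c] by (intro exI[of _ "c - 1"]) (auto intro!: mult_pos_neg)
  qed
  have up: "\<exists>c. x \<le> c \<and> c < y \<and> w c * w (c + 1) < 0" if "x < y" "w x < 0" "w y > 0" for x y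
  proof -
    obtain c where c: "x < c" "c \<le> y" "\<not> w c < 0" "\<And>t. x \<le> t \<Longrightarrow> t < c \<Longrightarrow> w t < 0"
      using first_exit[of x y "\<lambda>t. w t < 0"] \<open>x < y\<close> \<open>w x < 0\<close> \<open>w y > 0\<close> by auto
    then show ?thesis using nz[of c] by (intro exI[of _ "c - 1"]) (auto intro!: mult_neg_pos)
  qed
  have last: "w (t1 + P) > 0" using per sgn by (simp add: periodic_def)
  obtain c1 where c1: "t1 \<le> c1" "c1 < t2" "w c1 * w (c1 + 1) < 0" using down ord sgn by blast
  obtain c2 where c2: "t2 \<le> c2" "c2 < t3" "w c2 * w (c2 + 1) < 0" using up ord sgn by blast
  obtain c3 where c3: "t3 \<le> c3" "c3 < t4" "w c3 * w (c3 + 1) < 0" using down ord sgn by blast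
  obtain c4 where c4: "t4 \<le> c4" "c4 < t1 + P" "w c4 * w (c4 + 1) < 0" using up ord sgn last by blast
  let ?C = "{c1, c2, c3, c4}"
  have P: "P > 0" using per by (simp add: periodic_def)
  have inj: "inj_on (\<lambda>c. c mod P) {t1..<t1 + P}"
  proof (rule inj_onI)
    fix x y assume xy: "x \<in> {t1..<t1 + P}" "y \<in> {t1..<t1 + P}" "x mod P = y mod P"
    then have "P dvd x - y" by (simp add: mod_eq_dvd_iff)
    then show "x = y" using xy zdvd_imp_le[of P "x - y"] zdvd_imp_le[of P "y - x"]
      by (cases x y rule: linorder_cases) (auto simp: dvd_diff_commute)
  qed
  have sub: "?C \<subseteq> {t1..<t1 + P}" using c1 c2 c3 c4 ord by auto
  have "card ?C = 4" using c1 c2 c3 c4 by auto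
  then have "4 = card ((\<lambda>c. c mod P) ` ?C)"
    using card_image[OF inj_on_subset[OF inj sub]] by simp
  also have "\<dots> \<le> card {t \<in> {0..<P}. w t * w (t + 1) < 0}"
  proof (rule card_mono)
    have "w (c mod P) * w (c mod P + 1) = w c * w (c + 1)" for c
    proof -
      have "w (c mod P + 1) = w (c + 1)"
        using periodic_mod[OF per, of "c mod P + 1"] periodic_mod[OF per, of "c + 1"]
        by (simp add: mod_simps)
      then show ?thesis using periodic_mod[OF per] by simp
    qed
    then show "(\<lambda>c. c mod P) ` ?C \<subseteq> {t \<in> {0..<P}. w t * w (t + 1) < 0}"
      using c1 c2 c3 c4 P by auto
    have "{t \<in> {0..<P}. w t * w (t + 1) < 0} \<subseteq> {0..<P}" by auto
    then show "finite {t \<in> {0..<P}. w t * w (t + 1) < 0}" by (rule finite_subset) simp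
  qed
  finally show ?thesis .
qed

text \<open>The usable form of \<open>S\<^sub>c\<^sup>+ \<le> 2\<close>: filling the zeros at \<open>t2\<close> and \<open>t4\<close> with \<open>- 1\<close> and all
  other zeros with \<open>1\<close> makes the weak alternation strict.\<close>

lemma no_weak_alternation:
  fixes s :: "int \<Rightarrow> real"
  assumes per: "periodic P s" and var: "cyc_variation_plus (truncation P s) \<le> 2"
    and ord: "t1 < t2" "t2 < t3" "t3 < t4" "t4 < t1 + P"
    and sgn: "s t1 \<ge> 0" "s t2 \<le> 0" "s t3 \<ge> 0" "s t4 \<le> 0"
  shows False
proof -
  define w where "w t = (if s t \<noteq> 0 then s t
      else if t mod P = t2 mod P \<or> t mod P = t4 mod P then - 1 else 1)" for t
  have P: "P > 0" using per by (simp add: periodic_def)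
  have perw: "periodic P w" using per by (simp add: periodic_def w_def)
  have nz: "w t \<noteq> 0" for t by (simp add: w_def)
  have neq: "x mod P \<noteq> y mod P" if "x < y" "y < x + P" for x y
    using that zdvd_imp_le[of P "y - x"] mod_eq_dvd_iff[of y P x] by auto
  have "w t1 > 0" "w t3 > 0"
    using sgn neq[of t1 t2] neq[of t1 t4] neq[of t2 t3] neq[of t3 t4] ord by (auto simp: w_def)
  moreover have "w t2 < 0" "w t4 < 0" using sgn by (auto simp: w_def)
  ultimately have "4 \<le> card {t \<in> {0..<P}. w t * w (t + 1) < 0}"
    using four_alternations[OF perw nz ord] by simp
  moreover have "int (card {t \<in> {0..<P}. w t * w (t + 1) < 0}) \<le> cyc_variation (truncation P w)"
    by (rule cyc_variation_ge_sign_changes[OF perw nz])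
  moreover have "cyc_variation (truncation P w) \<le> cyc_variation_plus (truncation P s)"
    by (rule cyc_variation_le_plus) (use P in \<open>auto simp: truncation_def w_def\<close>)
  ultimately show False using var by linarith
qed

section \<open>The shape of one period of the relay output\<close>

text \<open>\<open>p\<close> is the first time of the block of ones. The offset is an integer so that the word can be
  instantiated at differences of times; the lengths are naturals since they bound sums later.\<close>

definition two_block_word ::
    "int \<Rightarrow> (int \<Rightarrow> real) \<Rightarrow> int \<Rightarrow> nat \<Rightarrow> nat \<Rightarrow> nat \<Rightarrow> nat \<Rightarrow> bool" where
  "two_block_word P s p a z b z' \<longleftrightarrow>
     P = int (a + z + b + z') \<and> 1 \<le> a \<and> z \<le> 1 \<and> 1 \<le> b \<and> z' \<le> 1 \<and>
     (\<forall>i. 0 \<le> i \<and> i < P \<longrightarrow>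
        s (p + i) = (if i < int a then 1 else if i < int (a + z) then 0
                     else if i < int (a + z + b) then - 1 else 0))"

text \<open>Restarting the period at the block of minus ones and negating exchanges the roles of the two
  blocks and of the two gaps, so that every bound for one block holds for the other.\<close>

lemma two_block_word_flip:
  assumes per: "periodic P s" and word: "two_block_word P s p a z b z'"
  shows "two_block_word P (\<lambda>t. - s t) (p + int (a + z)) b z' a z"
proof -
  have "- s (p + int (a + z) + i) = (if i < int b then 1 else if i < int (b + z') then 0
                     else if i < int (b + z' + a) then - 1 else 0)"
    if i: "0 \<le> i" "i < P" for i
  proof (cases "i < int (b + z')")
    case True
    then show ?thesis using word i
      by (auto simp: two_block_word_def add.assoc dest!: spec[of _ "int (a + z) + i"])
  next
    case False
    have "s (p + int (a + z) + i) = s (p + (int (a + z) + i - P))"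
      using per by (metis add_diff_eq diff_add_cancel add.assoc periodic_def)
    then show ?thesis using word i False
      by (auto simp: two_block_word_def dest!: spec[of _ "int (a + z) + i - P"])
  qed
  then show ?thesis using word by (auto simp: two_block_word_def)
qed

text \<open>Follow \<open>s\<close> from the start \<open>p\<close> of a block of ones to its end \<open>e1\<close>, to the start \<open>e2\<close> of the
  next block of minus ones and to the end \<open>e3\<close> of that block. A zero at \<open>e1\<close> that no minus one
  follows, or more than a single zero between \<open>e3\<close> and the next period, would create a weak alternation.\<close>

lemma two_block_word_exists:
  fixes s :: "int \<Rightarrow> real"
  assumes per: "periodic P s" and var: "cyc_variation_plus (truncation P s) \<le> 2"
    and val: "\<And>t. s t \<in> {- 1, 0, 1}" and pos: "s t = 1" and neg: "s t' = - 1"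
  obtains p a z b z' where "two_block_word P s p a z b z'"
proof -
  note noalt = no_weak_alternation[OF per var]
  have P: "P > 0" using per by (simp add: periodic_def)
  have shift: "s (x + P) = s x" for x using per by (simp add: periodic_def)
  have val': "s x = - 1 \<or> s x = 0 \<or> s x = 1" for x using val[of x] by auto
  obtain t0 where t0: "t' \<le> t0" "s t0 = 1" 
    using periodic_representative[OF per, of t' t] pos by (smt (verit))
  obtain p where p: "t' < p" "s p = 1" "\<And>x. t' \<le> x \<Longrightarrow> x < p \<Longrightarrow> s x \<noteq> 1"
    by (rule first_exit[of t' t0 "\<lambda>x. s x \<noteq> 1"]) (use t0 neg in auto)
  have last: "s (p + P - 1) \<noteq> 1" using p(1) p(3)[of "p - 1"] shift[of "p - 1"] by (simp add: algebra_simps)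
  obtain e1 where e1: "p < e1" "e1 \<le> p + P - 1" "s e1 \<noteq> 1" "\<And>x. p \<le> x \<Longrightarrow> x < e1 \<Longrightarrow> s x = 1"
    by (rule first_exit[of p "p + P - 1" "\<lambda>x. s x = 1"]) (use last p P in auto)
  have plus: "s (e1 - 1) = 1" using e1 by simp
  obtain z :: nat where z: "z \<le> 1" "s (e1 + int z) = - 1" "z = 1 \<Longrightarrow> s e1 = 0"
  proof (cases "s e1 = - 1")
    case True then show ?thesis using that[of 0] by simp
  next
    case False
    then have zero: "s e1 = 0" using val' e1 by auto
    \<comment> \<open>Otherwise \<open>e1 - 1\<close>, \<open>e1\<close>, \<open>e1 + 1\<close> and any later minus one alternate weakly.\<close>
    have "s (e1 + 1) = - 1"
    proof (rule ccontr)
      assume "s (e1 + 1) \<noteq> - 1"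
      then have next_nonneg: "s (e1 + 1) \<ge> 0" using val'[of "e1 + 1"] by auto
      obtain q where q: "e1 \<le> q" "q < e1 + P" "s q = - 1"
        using periodic_representative[OF per, of e1 t'] neg by (smt (verit))
      have "q \<noteq> e1" "q \<noteq> e1 + 1" "q \<noteq> e1 - 1 + P"
        using q zero next_nonneg plus shift[of "e1 - 1"] by auto
      then show False
        using noalt[of "e1 - 1" e1 "e1 + 1" q] plus zero next_nonneg q by auto
    qed
    then show ?thesis using that[of 1] zero by simp
  qed
  define e2 where "e2 = e1 + int z"
  have e2: "s e2 = - 1" "e2 < p + P"
  proof -
    show "s e2 = - 1" using z by (simp add: e2_def)
    then have "e2 \<noteq> p + P" using shift[of p] p by auto
    then show "e2 < p + P" using e1 z by (simp add: e2_def)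
  qed
  obtain e3 where e3: "e2 < e3" "e3 \<le> p + P" "s e3 \<noteq> - 1" "\<And>x. e2 \<le> x \<Longrightarrow> x < e3 \<Longrightarrow> s x = - 1"
    by (rule first_exit[of e2 "p + P" "\<lambda>x. s x = - 1"]) (use e2 shift[of p] p in auto)
  have e3_nonneg: "s e3 \<ge> 0" using val'[of e3] e3 by auto
  have last_nonpos: "s (p + P - 1) \<le> 0" using val'[of "p + P - 1"] last by auto
  \<comment> \<open>The last time \<open>p + P - 1\<close> before the next block of ones carries a value \<open>\<le> 0\<close>; if \<open>e3\<close> came
    earlier, it would complete a weak alternation.\<close>
  have e3_ge: "e3 \<ge> p + P - 1"
  proof (rule ccontr)
    assume "\<not> e3 \<ge> p + P - 1"
    then show False
      using noalt[of "e1 - 1" e2 e3 "p + P - 1"] plus e2 e3 e3_nonneg last_nonpos e1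
      by (auto simp: e2_def)
  qed
  have zero': "s e3 = 0" if "e3 = p + P - 1" using that e3_nonneg last_nonpos by simp
  define a b z' where "a = nat (e1 - p)" and "b = nat (e3 - e2)" and "z' = nat (p + P - e3)"
  have ints: "int a = e1 - p" "int b = e3 - e2" "int z' = p + P - e3"
    using e1 e3 by (auto simp: a_def b_def z'_def)
  have "s (p + i) = (if i < int a then 1 else if i < int (a + z) then 0
                     else if i < int (a + z + b) then - 1 else 0)" if i: "0 \<le> i" "i < P" for i
  proof -
    consider "p + i < e1" | "e1 \<le> p + i" "p + i < e2" | "e2 \<le> p + i" "p + i < e3" | "e3 \<le> p + i"
      by linarith
    then show ?thesis
    proof cases
      case 1 then show ?thesis using e1(4)[of "p + i"] ints i by simp
    next
      case 2
      then have "z = 1" "p + i = e1" using z(1) by (auto simp: e2_def)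
      then show ?thesis using z(3) ints 2 by (simp add: algebra_simps)
    next
      case 3 then show ?thesis using e3(4)[of "p + i"] ints by (simp add: e2_def)
    next
      case 4
      then have "e3 = p + P - 1" "p + i = e3" using e3_ge i by auto
      then show ?thesis using zero' ints e3(1) e1(1) by (auto simp: e2_def add_diff_eq)
    qed
  qed
  then have "two_block_word P s p a z b z'"
    unfolding two_block_word_def using ints z e1 e3 e3_ge by (auto simp: e2_def)
  then show ?thesis by (rule that)
qed

section \<open>Decreasing convex kernels\<close>

lemma convex_seq_increments:
  fixes h :: "nat \<Rightarrow> real"
  assumes convex: "\<And>k. 2 * h (k + 1) \<le> h k + h (k + 2)" and "p \<le> q"
  shows "h (p + d) + h q \<le> h p + h (q + d)"
proof -
  have step: "h (i + 1) - h i \<le> h (j + 1) - h j" if "i \<le> j" for i j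
    using that
  proof (induction j rule: dec_induct)
    case (step n)
    show ?case using step.IH convex[of n] by simp
  qed simp
  show ?thesis
  proof (induction d)
    case (Suc d)
    then show ?case using step[of "p + d" "q + d"] \<open>p \<le> q\<close> by simp
  qed simp
qed

lemma sum_lessThan_add:
  fixes f :: "nat \<Rightarrow> real"
  shows "sum f {..<m + n} = sum f {..<m} + (\<Sum>j<n. f (m + j))"
  by (induction n) (auto simp: add.assoc)

text \<open>Along the indices lie \<open>A\<close> outer terms, a gap \<open>z'\<close>, \<open>C\<close> inner terms, a gap \<open>z\<close> and \<open>D\<close> outer
  terms. If \<open>C \<le> A\<close>, monotonicity suffices. Otherwise let \<open>E = C - A\<close> be the number of inner terms
  that the left block cannot dominate one to one. The first and the last \<open>E\<close> inner terms are paired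
  from outside in, and each pair is dominated by the outer pair obtained by moving its left index
  down and its right index up by \<open>E + z\<close>. This is convexity, up to the shift by \<open>z'\<close>, which favours
  the left block. Room for the left partners is what \<open>C + z \<le> 2 * A\<close> provides. The \<open>A - E\<close> inner
  terms in the middle are dominated by the remaining \<open>A - E\<close> terms of the left block.\<close>

lemma convex_block_inequality:
  fixes h :: "nat \<Rightarrow> real"
  assumes dec: "decseq h" and nonneg: "\<And>k. 0 \<le> h k"
    and convex: "\<And>k. 2 * h (k + 1) \<le> h k + h (k + 2)"
    and C: "C + z \<le> 2 * A" "C \<le> A + D"
  shows "(\<Sum>j<C. h (A + z' + j)) \<le> (\<Sum>k<A. h k) + (\<Sum>j<D. h (A + z' + C + z + j))"
proof (cases "C \<le> A")
  case True
  have "(\<Sum>j<C. h (A + z' + j)) \<le> (\<Sum>j<C. h j)"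
    using dec by (intro sum_mono) (auto simp: decseq_def)
  also have "\<dots> \<le> (\<Sum>k<A. h k)" using True nonneg by (intro sum_mono2) auto
  finally show ?thesis using nonneg by (simp add: sum_nonneg add_increasing2)
next
  case False
  define E where "E = C - A"
  define M where "M = A - z - E"
  \<comment> \<open>The left block is cut into \<open>M\<close> terms, \<open>E\<close> partners of the pairs, and \<open>z\<close> terms; the partners
    stop \<open>z\<close> short of the end so that a pair moves symmetrically across the right gap.\<close>
  have eqs: "C = E + ((M + z) + E)" "A = (M + E) + z" using C False by (auto simp: E_def M_def)
  have ED: "E \<le> D" using C by (simp add: E_def)
  have inner: "(\<Sum>j<C. h (A + z' + j)) = (\<Sum>j<E. h (A + z' + j))
      + ((\<Sum>j<M + z. h (A + z' + (E + j))) + (\<Sum>j<E. h (A + z' + (E + (M + z) + j))))"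
    by (subst eqs(1)) (simp add: sum_lessThan_add add.assoc)
  have outer: "(\<Sum>k<A. h k) = (\<Sum>k<M. h k) + (\<Sum>j<E. h (M + j)) + (\<Sum>j<z. h (M + E + j))"
    by (subst eqs(2)) (simp only: sum_lessThan_add)
  have mid: "(\<Sum>j<M + z. h (A + z' + (E + j))) \<le> (\<Sum>k<M. h k) + (\<Sum>j<z. h (M + E + j))"
  proof -
    have "(\<Sum>j<M. h (A + z' + (E + j))) \<le> (\<Sum>k<M. h k)"
      using dec by (intro sum_mono) (auto simp: decseq_def)
    moreover have "(\<Sum>j<z. h (A + z' + (E + (M + j)))) \<le> (\<Sum>j<z. h (M + E + j))"
      using dec by (intro sum_mono) (auto simp: decseq_def)
    ultimately show ?thesis by (simp add: sum_lessThan_add)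
  qed
  have pair: "h (A + z' + j) + h (A + z' + (C - Suc j))
      \<le> h (M + j) + h (A + z' + C + z + (E - Suc j))" if "j < E" for j
  proof -
    have "h (M + j + (E + z)) + h (A + z' + (C - Suc j))
        \<le> h (M + j) + h (A + z' + (C - Suc j) + (E + z))"
      by (rule convex_seq_increments[OF convex]) (use eqs that in simp)
    moreover have "h (A + z' + j) \<le> h (M + j + (E + z))"
      by (rule decseqD[OF dec]) (use eqs in simp)
    moreover have "A + z' + (C - Suc j) + (E + z) = A + z' + C + z + (E - Suc j)"
      using that eqs by simp
    ultimately show ?thesis by simp
  qed
  have rev_inner: "(\<Sum>j<E. h (A + z' + (E + (M + z) + j))) = (\<Sum>j<E. h (A + z' + (C - Suc j)))"
  proof (subst sum.nat_diff_reindex[symmetric], rule sum.cong[OF refl])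
    fix j assume "j \<in> {..<E}"
    then have "E + (M + z) + (E - Suc j) = C - Suc j" using eqs(1) by auto
    then show "h (A + z' + (E + (M + z) + (E - Suc j))) = h (A + z' + (C - Suc j))" by simp
  qed
  have rev_outer: "(\<Sum>j<E. h (A + z' + C + z + (E - Suc j))) = (\<Sum>j<E. h (A + z' + C + z + j))"
    by (rule sum.nat_diff_reindex)
  have "(\<Sum>j<E. h (A + z' + j)) + (\<Sum>j<E. h (A + z' + (C - Suc j)))
      \<le> (\<Sum>j<E. h (M + j)) + (\<Sum>j<E. h (A + z' + C + z + (E - Suc j)))"
    unfolding sum.distrib[symmetric] using pair by (intro sum_mono) auto
  moreover have "(\<Sum>j<E. h (A + z' + C + z + j)) \<le> (\<Sum>j<D. h (A + z' + C + z + j))"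
    using ED nonneg by (intro sum_mono2) auto
  ultimately show ?thesis using inner outer mid rev_inner rev_outer by linarith
qed

section \<open>Convolution with a causal kernel\<close>

lemma conv_op_causal:
  fixes g x :: "int \<Rightarrow> real"
  assumes causal: "\<And>t. t < 0 \<Longrightarrow> g t = 0" and summ: "(\<lambda>t. \<bar>g t\<bar>) summable_on UNIV"
    and bdd: "\<And>t. \<bar>x t\<bar> \<le> 1"
  shows "conv_op g x t = (\<Sum>k. g (int k) * x (t - int k))"
proof -
  let ?f = "\<lambda>k. g k * x (t - k)"
  have "(\<lambda>k. norm (?f k)) summable_on UNIV"
    by (rule summable_on_comparison_test[OF summ])
       (use bdd in \<open>auto simp: abs_mult intro!: mult_left_le\<close>)
  then have fsum: "?f summable_on UNIV" by (rule abs_summable_summable)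
  have "conv_op g x t = infsum ?f UNIV"
    unfolding conv_op_def
    by (rule infsum_reindex_bij_witness[of _ "\<lambda>k. t - k" "\<lambda>k. t - k"]) auto
  also have "\<dots> = infsum ?f (range int)"
    by (rule infsum_cong_neutral) (auto simp: causal image_iff, metis causal not_less zero_le_imp_eq_int)
  finally have conv: "conv_op g x t = infsum ?f (range int)" .
  have "?f summable_on range int" by (rule summable_on_subset_banach[OF fsum]) simp
  then have "(?f has_sum conv_op g x t) (range int)" using conv by simp
  then have "((?f \<circ> int) has_sum conv_op g x t) UNIV" by (subst has_sum_reindex[symmetric]) auto
  then have "(?f \<circ> int) sums conv_op g x t" by (rule has_sum_imp_sums)
  then show ?thesis by (simp add: sums_iff o_def)
qed

section \<open>The relay feedback loop\<close>

lemma rel_minus: "\<chi> \<ge> 0 \<Longrightarrow> rel \<chi> (- x) = - rel \<chi> x"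
  by (auto simp: rel_def)

text \<open>The kernel is indexed by the natural numbers, which encodes causality. The assumptions are
  invariant under \<open>u \<mapsto> - u\<close>, and this symmetry is used through reinterpretation of the locale.\<close>

locale relay_loop =
  fixes h :: "nat \<Rightarrow> real" and \<chi> :: real and D P :: int and u :: "int \<Rightarrow> real"
  assumes dec: "decseq h" and summ: "summable h"
    and convex: "\<And>k. 2 * h (k + 1) \<le> h k + h (k + 2)"
    and chi: "0 \<le> \<chi>" and delay: "0 \<le> D" "D \<le> P"
    and per: "periodic P u"
    and loop: "\<And>t. u t = - (\<Sum>k. h k * rel \<chi> (u (t - D - int k)))"
begin

abbreviation s :: "int \<Rightarrow> real" where "s t \<equiv> rel \<chi> (u t)"

abbreviation y :: "int \<Rightarrow> real" where "y t \<equiv> \<Sum>k. h k * s (t - int k)"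

lemma flip: "relay_loop h \<chi> D P (\<lambda>t. - u t)"
proof
  show "periodic P (\<lambda>t. - u t)" using per by (simp add: periodic_def)
  have "summable (\<lambda>k. h k * s (t - D - int k))" for t
    by (rule summable_comparison_test'[OF summ, of 0])
       (use dec summ decseq_ge summable_LIMSEQ_zero in \<open>auto simp: rel_def\<close>)
  then show "- u t = - (\<Sum>k. h k * rel \<chi> (- u (t - D - int k)))" for t
    using loop[of t] by (simp add: rel_minus[OF chi] suminf_minus)
qed (use dec summ convex chi delay in auto)

lemma nonneg: "0 \<le> h k"
  using decseq_ge[OF dec summable_LIMSEQ_zero[OF summ]] .

lemma output_abs_le: "\<bar>s t\<bar> \<le> 1" by (simp add: rel_def)

lemma output_periodic: "periodic P s" using per by (simp add: periodic_def)

lemma summable_response: "summable (\<lambda>k. h k * s (t - int k))"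
  by (rule summable_comparison_test'[OF summ, of 0])
     (use nonneg output_abs_le in \<open>auto simp: abs_mult intro!: mult_left_le\<close>)

text \<open>The increment of \<open>y\<close> at \<open>t\<close> is \<open>h 0\<close> minus the \<open>s\<close>-weighted sum of the decrements of \<open>h\<close>.
  The decrements are nonnegative and add up to \<open>h 0\<close>, and the weights are at most 1.\<close>

lemma response_nondecreasing:
  assumes "s t = 1"
  shows "y (t - 1) \<le> y t"
proof -
  have tele: "(\<lambda>k. h k - h (Suc k)) sums (h 0 - 0)"
    by (rule telescope_sums'[OF summable_LIMSEQ_zero[OF summ]])
  have s1: "summable (\<lambda>k. h k * s (t - 1 - int k))" by (rule summable_response)
  have s2: "summable (\<lambda>k. h (Suc k) * s (t - int (Suc k)))"
    using summable_response[of t] by (subst summable_Suc_iff)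
  have "y t = (\<Sum>k. h (Suc k) * s (t - int (Suc k))) + h 0"
    using suminf_split_head[OF summable_response[of t]] assms by simp
  moreover have "y (t - 1) - (\<Sum>k. h (Suc k) * s (t - int (Suc k)))
      = (\<Sum>k. (h k - h (Suc k)) * s (t - 1 - int k))"
    using suminf_diff[OF s1 s2] by (simp add: algebra_simps)
  moreover have "(\<Sum>k. (h k - h (Suc k)) * s (t - 1 - int k)) \<le> (\<Sum>k. h k - h (Suc k))"
  proof (rule suminf_le)
    show "(h k - h (Suc k)) * s (t - 1 - int k) \<le> h k - h (Suc k)" for k
      using dec by (intro mult_left_le) (auto simp: rel_def decseq_Suc_iff)
    show "summable (\<lambda>k. (h k - h (Suc k)) * s (t - 1 - int k))"
      using summable_diff[OF s1 s2] by (simp add: algebra_simps)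
    show "summable (\<lambda>k. h k - h (Suc k))" using tele by (rule sums_summable)
  qed
  moreover have "(\<Sum>k. h k - h (Suc k)) = h 0" using tele by (simp add: sums_iff)
  ultimately show ?thesis by linarith
qed

lemma input_falls: "s (t - D) = 1 \<Longrightarrow> u t \<le> u (t - 1)"
  using response_nondecreasing[of "t - D"] loop[of t] loop[of "t - 1"] by (simp add: algebra_simps)

lemma input_rises:
  assumes "s (t - D) = - 1"
  shows "u (t - 1) \<le> u t"
proof -
  interpret f: relay_loop h \<chi> D P "\<lambda>t. - u t" by (rule flip)
  show ?thesis using f.input_falls[of t] assms by (simp add: rel_minus[OF chi])
qed

text \<open>The feedback is negative: an output that is never \<open>- 1\<close> gives \<open>y \<ge> 0\<close>, hence \<open>u \<le> 0\<close>.\<close>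

lemma positive_output_imp_negative:
  assumes "s t = 1"
  obtains t' where "s t' = - 1"
proof -
  have "\<exists>t'. s t' = - 1"
  proof (rule ccontr)
    assume none: "\<nexists>t'. s t' = - 1"
    have "0 \<le> s x" for x using none spec[of "\<lambda>x. s x \<noteq> - 1" x] by (auto simp: rel_def split: if_splits)
    then have "0 \<le> y (t - D)" using nonneg by (intro suminf_nonneg summable_response) auto
    then show False using loop[of t] assms chi by (simp add: rel_def split: if_splits)
  qed
  then show ?thesis using that by blast
qed

text \<open>The value \<open>u p > \<chi>\<close> is compared with the values at the offsets \<open>D - 1\<close> and \<open>D - 1 - z'\<close>, from
  which \<open>u\<close> starts to fall and up to which it rises. If \<open>D > a + z'\<close>, both offsets lie outside the
  block of ones, where \<open>u \<le> \<chi>\<close>. But one of them bounds \<open>u p\<close>, depending on whether the shift by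
  \<open>D\<close> puts \<open>p + P\<close> on the falling or on the rising stretch.\<close>

lemma delay_le_block:
  assumes word: "two_block_word P s p a z b z'"
  shows "D \<le> int (a + z')"
proof (rule ccontr)
  assume long: "\<not> D \<le> int (a + z')"
  have P: "P = int (a + z + b + z')" "z \<le> 1" "z' \<le> 1" "1 \<le> a"
    using word by (auto simp: two_block_word_def)
  have shift: "u (t + P) = u t" for t using per by (simp add: periodic_def)
  have out: "s (p + i) = (if i < int a then 1 else if i < int (a + z) then 0
                     else if i < int (a + z + b) then - 1 else 0)" if "0 \<le> i" "i < P" for i
    using word that by (auto simp: two_block_word_def)
  have small: "u (p + i) \<le> \<chi>" if "int a \<le> i" "i < P" for i
    using out[of i] that chi by (auto simp: rel_def split: if_splits)
  have u0: "u (p + P) > \<chi>"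
    using out[of 0] P shift[of p] by (auto simp: rel_def split: if_splits)
  show False
  proof (cases "P - D < int a")
    case True
    have "- u (p + D - 1) \<le> - u (p + P)"
    proof (rule int_step_mono)
      fix t assume t: "p + D - 1 \<le> t" "t < p + P"
      have "s (t + 1 - D) = 1" using out[of "t + 1 - D - p"] t True P by simp
      then show "- u t \<le> - u (t + 1)" using input_falls[of "t + 1"] by simp
    qed (use delay in simp)
    then show False using u0 small[of "D - 1"] long delay by (simp add: add_diff_eq)
  next
    case False
    have "u (p + P) \<le> u (p + D - int z' - 1 + P)"
    proof (rule int_step_mono)
      fix t assume t: "p + P \<le> t" "t < p + D - int z' - 1 + P"
      have "s (t + 1 - D) = - 1" using out[of "t + 1 - D - p"] t False P by simp
      then show "u t \<le> u (t + 1)" using input_rises[of "t + 1"] by simp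
    qed (use long P in simp)
    also have "\<dots> = u (p + (D - int z' - 1))" using shift[of "p + D - int z' - 1"] by (simp add: algebra_simps)
    also have "\<dots> \<le> \<chi>" using long delay by (intro small) auto
    finally show False using u0 by simp
  qed
qed

text \<open>Here \<open>q\<close> is \<open>D\<close> steps before the last time of the block of ones, so that \<open>A = a - D\<close> ones have
  just been emitted. The period bound and \<open>b \<le> a\<close> force \<open>a \<ge> 2 * D + 1\<close>, which is the room that
  \<open>convex_block_inequality\<close> asks for with \<open>C = b\<close>. It applies to each period of the
  convolution sum, since shifting a decreasing convex sequence keeps these properties.\<close>

lemma period_le_of_longer_block:
  assumes word: "two_block_word P s p a z b z'" and "b \<le> a"
  shows "P \<le> 4 * D + 2"
proof (rule ccontr)
  assume large: "\<not> P \<le> 4 * D + 2"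
  define d where "d = nat D"
  define A where "A = a - d"
  define N where "N = nat P"
  have P: "P = int (a + z + b + z')" "z \<le> 1" "z' \<le> 1" "1 \<le> a"
    using word by (auto simp: two_block_word_def)
  have d: "int d = D" using delay by (simp add: d_def)
  have a: "a \<ge> 2 * d + 1" using large P d \<open>b \<le> a\<close> by linarith
  have aA: "a = A + d" using a by (simp add: A_def)
  have N: "N = A + z' + b + z + d" "int N = P" "N > 0" using P aA by (auto simp: N_def)
  have out: "s (p + i) = (if i < int a then 1 else if i < int (a + z) then 0
                     else if i < int (a + z + b) then - 1 else 0)" if "0 \<le> i" "i < P" for i
    using word that by (auto simp: two_block_word_def)
  define q where "q = p + int A - 1"
  have recent: "s (q - int k) = 1" if "k < A" for k
    using out[of "int A - 1 - int k"] that aA P by (simp add: q_def algebra_simps)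
  have older: "s (q - int k) = (if k < A + z' then 0 else if k < A + z' + b then - 1
      else if k < A + z' + b + z then 0 else 1)" if "A \<le> k" "k < N" for k
  proof -
    have "p + (int A - 1 - int k + P) = (q - int k) + P" by (simp add: q_def)
    then have "s (q - int k) = s (p + (int A - 1 - int k + P))"
      using output_periodic by (simp only: periodic_def)
    then show ?thesis using out[of "int A - 1 - int k + P"] that aA P N by auto
  qed
  have block: "0 \<le> (\<Sum>k<N. c k * s (q - int k))"
    if c: "decseq c" "\<And>k. 0 \<le> c k" "\<And>k. 2 * c (k + 1) \<le> c k + c (k + 2)" for c :: "nat \<Rightarrow> real"
  proof -
    have "(\<Sum>k<N. c k * s (q - int k)) = (\<Sum>k<A. c k * s (q - int k))
        + (\<Sum>j<z'. c (A + j) * s (q - int (A + j)))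
        + (\<Sum>j<b. c (A + z' + j) * s (q - int (A + z' + j)))
        + (\<Sum>j<z. c (A + z' + b + j) * s (q - int (A + z' + b + j)))
        + (\<Sum>j<d. c (A + z' + b + z + j) * s (q - int (A + z' + b + z + j)))"
      by (simp only: N(1) sum_lessThan_add)
    also have "(\<Sum>k<A. c k * s (q - int k)) = (\<Sum>k<A. c k)"
      using recent by (intro sum.cong) auto
    also have "(\<Sum>j<z'. c (A + j) * s (q - int (A + j))) = 0"
      by (intro sum.neutral ballI, subst older) (use N(1) in auto)
    also have "(\<Sum>j<b. c (A + z' + j) * s (q - int (A + z' + j))) = - (\<Sum>j<b. c (A + z' + j))"
      unfolding sum_negf[symmetric] by (intro sum.cong refl, subst older) (use N(1) in auto)
    also have "(\<Sum>j<z. c (A + z' + b + j) * s (q - int (A + z' + b + j))) = 0"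
      by (intro sum.neutral ballI, subst older) (use N(1) in auto)
    also have "(\<Sum>j<d. c (A + z' + b + z + j) * s (q - int (A + z' + b + z + j)))
        = (\<Sum>j<d. c (A + z' + b + z + j))"
      by (intro sum.cong refl, subst older) (use N(1) in auto)
    finally show ?thesis
      using convex_block_inequality[OF c, of b z A d z'] a aA \<open>b \<le> a\<close> P by simp
  qed
  have "(\<lambda>k. h k * s (q - int k)) sums y q" using summable_response by (rule summable_sums)
  from sums_group[OF this N(3)]
  have groups: "(\<lambda>n. \<Sum>k\<in>{n * N..<n * N + N}. h k * s (q - int k)) sums y q" .
  have "0 \<le> (\<Sum>k\<in>{n * N..<n * N + N}. h k * s (q - int k))" for n
  proof -
    have per_s: "s (q - int (k + n * N)) = s (q - int k)" for k
    proof -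
      have "q - int (k + n * N) = (q - int k) + (- int n) * P" using N(2) by simp
      then show ?thesis using periodic_mult[OF output_periodic] by (simp only:)
    qed
    have "(\<Sum>k\<in>{n * N..<n * N + N}. h k * s (q - int k)) = (\<Sum>k<N. h (k + n * N) * s (q - int k))"
      using sum.shift_bounds_nat_ivl[of "\<lambda>k. h k * s (q - int k)" 0 "n * N" N] per_s
      by (simp add: atLeast0LessThan add.commute)
    moreover have "0 \<le> (\<Sum>k<N. h (k + n * N) * s (q - int k))"
    proof (rule block)
      show "decseq (\<lambda>k. h (k + n * N))" using dec by (simp add: decseq_def)
      show "2 * h (k + 1 + n * N) \<le> h (k + n * N) + h (k + 2 + n * N)" for k
        using convex[of "k + n * N"] by (simp add: algebra_simps)
    qed (rule nonneg)
    ultimately show ?thesis by simp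
  qed
  then have "0 \<le> y q" using sums_le[OF _ sums_zero groups] by blast
  moreover have "u (q + D) = - y q" using loop[of "q + D"] by simp
  moreover have "s (q + D) = 1" using out[of "int a - 1"] aA d P by (simp add: q_def algebra_simps)
  ultimately show False using chi by (simp add: rel_def split: if_splits)
qed

theorem period_bounds:
  assumes var: "cyc_variation_plus (truncation P s) \<le> 2" and "\<exists>t. u t \<noteq> 0"
  shows "2 * D \<le> P \<and> P \<le> 4 * D + 2"
proof -
  interpret f: relay_loop h \<chi> D P "\<lambda>t. - u t" by (rule flip)
  have val: "s t \<in> {- 1, 0, 1}" for t by (simp add: rel_def)
  have "\<exists>t. s t \<noteq> 0"
  proof (rule ccontr)
    assume "\<nexists>t. s t \<noteq> 0"
    then have "u t = 0" for t using loop[of t] by simp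
    then show False using assms(2) by simp
  qed
  then obtain t0 where "s t0 \<noteq> 0" by blast
  then have "s t0 = 1 \<or> s t0 = - 1" using val[of t0] by auto
  then have "\<exists>t t'. s t = 1 \<and> s t' = - 1"
  proof
    assume "s t0 = 1"
    then show ?thesis using positive_output_imp_negative[of t0] by blast
  next
    assume "s t0 = - 1"
    moreover from this have "f.s t0 = 1" by (simp add: rel_minus[OF chi])
    then obtain t where "f.s t = - 1" using f.positive_output_imp_negative[of t0] by blast
    then have "s t = 1" by (simp add: rel_minus[OF chi])
    ultimately show ?thesis by blast
  qed
  then obtain t t' where tt': "s t = 1" "s t' = - 1" by blast
  obtain p a z b z' where word: "two_block_word P s p a z b z'"
    using two_block_word_exists[OF output_periodic var val tt'] .
  have word': "two_block_word P f.s (p + int (a + z)) b z' a z"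
    using two_block_word_flip[OF output_periodic word] by (simp add: rel_minus[OF chi])
  have "D \<le> int (a + z')" "D \<le> int (b + z)"
    using delay_le_block[OF word] f.delay_le_block[OF word'] .
  moreover have "P = int (a + z + b + z')" using word by (simp add: two_block_word_def)
  moreover have "P \<le> 4 * D + 2"
    using period_le_of_longer_block[OF word] f.period_le_of_longer_block[OF word'] nat_le_linear by blast
  ultimately show ?thesis by simp
qed

end

section \<open>Self-oscillations of the relay system\<close>

theorem corollary2:
  fixes Pd P :: int and \<chi>0 :: real and g0 u :: "int \<Rightarrow> real"
  assumes "Pd > 1"
    and "\<chi>0 \<ge> 0"
    and "\<And>t. t < 0 \<Longrightarrow> g0 t = 0"
    and "g0 0 > 0"
    and "(\<lambda>t. \<bar>g0 t\<bar>) summable_on UNIV"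
    and "supp g0 = {0..}"
    and "strict_antimono_on (supp g0) g0"
    and "\<And>t. t \<ge> 1 \<Longrightarrow> g0 (t + 1) - g0 t \<ge> g0 t - g0 (t - 1)"
    and "P \<ge> Pd"
    and "self_oscillation g0 \<chi>0 Pd P u"
    and "cyc_variation (cyc_diff (truncation P u)) = 2"
    and "cyc_variation_plus (map (rel \<chi>0) (truncation P u)) = 2"
  shows "2 * Pd \<le> P \<and> P \<le> 4 * Pd + 2"
proof -
  define h where "h k = g0 (int k)" for k
  have per: "periodic P u" and sys: "relay_system g0 \<chi>0 Pd u"
    using assms(10) by (auto simp: self_oscillation_def)
  interpret relay_loop h \<chi>0 Pd P u
  proof
    show "decseq h"
      using assms(6,7) by (intro decseq_SucI) (auto simp: h_def monotone_on_def intro!: less_imp_le)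
    have "(\<lambda>t. \<bar>g0 t\<bar>) summable_on range int"
      by (rule summable_on_subset_banach[OF assms(5)]) simp
    then have "(\<lambda>k. norm (h k)) summable_on UNIV"
      by (subst (asm) summable_on_reindex) (auto simp: o_def h_def)
    then show "summable h"
      by (rule summable_on_imp_summable[OF abs_summable_summable])
    show "2 * h (k + 1) \<le> h k + h (k + 2)" for k
      using assms(8)[of "int k + 1"] by (simp add: h_def algebra_simps)
    show "u t = - (\<Sum>k. h k * rel \<chi>0 (u (t - Pd - int k)))" for t
    proof -
      have "u t = - conv_op g0 (\<lambda>\<tau>. rel \<chi>0 (u \<tau>)) (t - Pd)"
        using sys unfolding relay_system_def by (rule spec)
      also have "conv_op g0 (\<lambda>\<tau>. rel \<chi>0 (u \<tau>)) (t - Pd)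
          = (\<Sum>k. h k * rel \<chi>0 (u (t - Pd - int k)))"
        unfolding h_def by (rule conv_op_causal[OF assms(3,5)]) (auto simp: rel_def)
      finally show ?thesis .
    qed
  qed (use assms(1,2,9) per in auto)
  \<comment> \<open>The zero solution has cyclic variation \<open>- 1\<close>, so it is not an oscillation.\<close>
  have "\<exists>t. u t \<noteq> 0"
  proof (rule ccontr)
    assume "\<nexists>t. u t \<noteq> 0"
    then have zero: "u t = 0" for t by simp
    have "cyc_diff (truncation P u) \<noteq> []"
      using assms(1,9) by (simp add: cyc_diff_def truncation_def)
    moreover have "\<forall>x\<in>set (cyc_diff (truncation P u)). x = 0"
      by (auto simp: cyc_diff_def truncation_def zero)
    ultimately show False using cyc_variation_zero assms(11) by fastforce
  qed
  moreover have "cyc_variation_plus (truncation P s) \<le> 2"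
    using assms(12) by (simp add: truncation_def o_def)
  ultimately show ?thesis by (intro period_bounds)
qed

end
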